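(* Let $X$ be a compact Hausdorff space containing at least two points, and let $E$ be an infinite dimensional Banach space which is a linear subspace of $C(X)$, continuously included in $(C(X),\|\cdot\|_\infty)$, such that the evaluations $\{\delta_x : x\in X\}$ are linearly independent in $E^*$, and such that $E$ contains a nowhere vanishing function. Let $w:X\to\mathbb{C}$ and $\varphi:X\to X$ be continuous and such that the weighted composition operator $C_{w,\varphi}:E\to E$, $f\mapsto w\cdot(f\circ\varphi)$, is well defined and continuous. Then $C_{w,\varphi}:E\to E$ is not weakly supercyclic.
   Context: $C(X)$ is the space of continuous functions $X\to\mathbb{C}$, and $\|\cdot\|_\infty$ is the supremum norm. For $x\in X$, $\delta_x$ is the functional $f\mapsto f(x)$ on $E$. All spaces are complex. A continuous linear operator $T:E\to E$ is weakly supercyclic if there is $f\in E$ such that $\{\lambda T^n f:\lambda\in\mathbb{C},\ n=0,1,2,\dots\}$ is dense in $E$ for the weak topology of $E$. *)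

theory Defs
  imports "HOL-Analysis.Analysis" "HOL-Library.Function_Algebras"
begin

section \<open>Normed spaces of complex-valued functions\<close>

text \<open>The addition, subtraction and zero of functions are the pointwise ones. Complex normed
  spaces are not available as a type class, so a normed space is given by a carrier \<open>E\<close> and a
  norm \<open>N\<close>, whose values outside \<open>E\<close> are irrelevant.\<close>

definition cscale :: "complex \<Rightarrow> ('a \<Rightarrow> complex) \<Rightarrow> ('a \<Rightarrow> complex)" where
  "cscale c f = (\<lambda>x. c * f x)"

global_interpretation cfun: vector_space "cscale :: complex \<Rightarrow> ('a \<Rightarrow> complex) \<Rightarrow> ('a \<Rightarrow> complex)"
  by unfold_locales (auto simp: cscale_def fun_eq_iff algebra_simps)

definition infinite_dimensional :: "('a \<Rightarrow> complex) set \<Rightarrow> bool" where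
  "infinite_dimensional E \<longleftrightarrow> \<not> (\<exists>B. finite B \<and> B \<subseteq> E \<and> E \<subseteq> cfun.span B)"

definition norm_on :: "('a \<Rightarrow> complex) set \<Rightarrow> (('a \<Rightarrow> complex) \<Rightarrow> real) \<Rightarrow> bool" where
  "norm_on E N \<longleftrightarrow>
     (\<forall>f\<in>E. 0 \<le> N f) \<and>
     (\<forall>f\<in>E. N f = 0 \<longleftrightarrow> f = 0) \<and>
     (\<forall>c. \<forall>f\<in>E. N (cscale c f) = cmod c * N f) \<and>
     (\<forall>f\<in>E. \<forall>g\<in>E. N (f + g) \<le> N f + N g)"

text \<open>The locale \<open>Metric_space\<close> requires symmetry and nonnegativity on the whole type, hence the
  value 0 outside \<open>E\<close>.\<close>

definition norm_dist ::
  "('a \<Rightarrow> complex) set \<Rightarrow> (('a \<Rightarrow> complex) \<Rightarrow> real) \<Rightarrow> ('a \<Rightarrow> complex) \<Rightarrow> ('a \<Rightarrow> complex) \<Rightarrow> real" where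
  "norm_dist E N f g = (if f \<in> E \<and> g \<in> E then N (f - g) else 0)"

definition norm_topology ::
  "('a \<Rightarrow> complex) set \<Rightarrow> (('a \<Rightarrow> complex) \<Rightarrow> real) \<Rightarrow> ('a \<Rightarrow> complex) topology" where
  "norm_topology E N = Metric_space.mtopology E (norm_dist E N)"

definition banach_space_on :: "('a \<Rightarrow> complex) set \<Rightarrow> (('a \<Rightarrow> complex) \<Rightarrow> real) \<Rightarrow> bool" where
  "banach_space_on E N \<longleftrightarrow>
     cfun.subspace E \<and> norm_on E N \<and> Metric_space.mcomplete E (norm_dist E N)"

lemma norm_onD:
  assumes "norm_on E N"
  shows "f \<in> E \<Longrightarrow> 0 \<le> N f"
    and "f \<in> E \<Longrightarrow> N f = 0 \<longleftrightarrow> f = 0"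
    and "f \<in> E \<Longrightarrow> N (cscale c f) = cmod c * N f"
    and "f \<in> E \<Longrightarrow> g \<in> E \<Longrightarrow> N (f + g) \<le> N f + N g"
  using assms by (simp_all add: norm_on_def)

lemma Metric_space_norm_dist:
  assumes E: "cfun.subspace E" and N: "norm_on E N"
  shows "Metric_space E (norm_dist E N)"
proof
  note diff = cfun.subspace_diff[OF E]
  fix f g h
  show "0 \<le> norm_dist E N f g"
    using norm_onD(1)[OF N diff] by (simp add: norm_dist_def)
  show "norm_dist E N f g = norm_dist E N g f"
  proof (cases "f \<in> E \<and> g \<in> E")
    case True
    have eq: "cscale (-1) (g - f) = f - g" by simp
    have "N (f - g) = N (g - f)"
      using norm_onD(3)[OF N diff[of g f], of "-1"] True
      by (simp only: eq norm_minus_cancel norm_one mult_1)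
    then show ?thesis
      using True by (simp only: norm_dist_def if_True simp_thms)
  qed (auto simp: norm_dist_def)
  {
    assume "f \<in> E" "g \<in> E"
    then show "norm_dist E N f g = 0 \<longleftrightarrow> f = g"
      using norm_onD(2)[OF N diff[of f g]] by (simp add: norm_dist_def)
  }
  assume fgh: "f \<in> E" "g \<in> E" "h \<in> E"
  have eq: "(f - g) + (g - h) = f - h" by simp
  show "norm_dist E N f h \<le> norm_dist E N f g + norm_dist E N g h"
    using norm_onD(4)[OF N diff[of f g] diff[of g h]] fgh
    by (simp only: norm_dist_def eq simp_thms if_True)
qed

lemma topspace_norm_topology:
  "cfun.subspace E \<Longrightarrow> norm_on E N \<Longrightarrow> topspace (norm_topology E N) = E"
  by (simp add: norm_topology_def Metric_space.topspace_mtopology Metric_space_norm_dist)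


section \<open>The space of continuous functions\<close>

definition cont_funs :: "('a::topological_space \<Rightarrow> complex) set" where
  "cont_funs = {f. continuous_on UNIV f}"

definition sup_norm :: "('a \<Rightarrow> complex) \<Rightarrow> real" where
  "sup_norm f = (SUP x. cmod (f x))"

lemma subspace_cont_funs: "cfun.subspace cont_funs"
  unfolding cfun.subspace_def cont_funs_def cscale_def plus_fun_def zero_fun_def
  by (auto intro!: continuous_intros)

lemma norm_on_cont_funs:
  assumes "compact (UNIV :: 'a::topological_space set)"
  shows "norm_on (cont_funs :: ('a \<Rightarrow> complex) set) sup_norm"
proof -
  have bdd: "bdd_above (range (\<lambda>x. cmod (f x)))" if "f \<in> cont_funs" for f :: "'a \<Rightarrow> complex"
    using that assms
    by (intro bounded_imp_bdd_above compact_imp_bounded compact_continuous_image)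
       (auto simp: cont_funs_def intro!: continuous_intros)
  have le: "cmod (f x) \<le> sup_norm f" if "f \<in> cont_funs" for f :: "'a \<Rightarrow> complex" and x
    unfolding sup_norm_def by (rule cSUP_upper[OF UNIV_I bdd[OF that]])
  have nn: "0 \<le> sup_norm f" if "f \<in> cont_funs" for f :: "'a \<Rightarrow> complex"
    using le[OF that] norm_ge_zero order_trans by blast
  have least: "sup_norm f \<le> c" if "\<And>x. cmod (f x) \<le> c" for f :: "'a \<Rightarrow> complex" and c
    unfolding sup_norm_def using that by (intro cSUP_least) auto
  have scale_le: "sup_norm (cscale c f) \<le> cmod c * sup_norm f" if "f \<in> cont_funs"
    for c and f :: "'a \<Rightarrow> complex"
    by (rule least) (simp add: cscale_def norm_mult mult_left_mono le[OF that])
  have zero: "sup_norm f = 0 \<longleftrightarrow> f = 0" if "f \<in> cont_funs" for f :: "'a \<Rightarrow> complex"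
  proof
    assume "sup_norm f = 0"
    then have "cmod (f x) \<le> 0" for x using le[OF that, of x] by simp
    then show "f = 0" by (auto simp: fun_eq_iff)
  qed (simp add: sup_norm_def)
  have scale: "sup_norm (cscale c f) = cmod c * sup_norm f" if f: "f \<in> cont_funs"
    for c and f :: "'a \<Rightarrow> complex"
  proof (cases "c = 0")
    case True
    then have "cscale c f = 0" by (simp add: cscale_def fun_eq_iff)
    with True show ?thesis using zero[of 0] by (simp add: sup_norm_def)
  next
    case False
    have cf: "cscale c f \<in> cont_funs"
      using cfun.subspace_scale[OF subspace_cont_funs f] .
    have "sup_norm f = sup_norm (cscale (inverse c) (cscale c f))"
      using False by simp
    also have "\<dots> \<le> cmod (inverse c) * sup_norm (cscale c f)"
      by (rule scale_le[OF cf])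
    finally have "cmod c * sup_norm f \<le> sup_norm (cscale c f)"
      using False by (simp add: norm_divide field_simps)
    with scale_le[OF f, of c] show ?thesis by simp
  qed
  have add: "sup_norm (f + g) \<le> sup_norm f + sup_norm g"
    if "f \<in> cont_funs" "g \<in> cont_funs" for f g :: "'a \<Rightarrow> complex"
  proof (rule least)
    fix x
    show "cmod ((f + g) x) \<le> sup_norm f + sup_norm g"
      using norm_triangle_ineq[of "f x" "g x"] le[OF that(1), of x] le[OF that(2), of x] by simp
  qed
  show ?thesis
    unfolding norm_on_def using nn zero scale add by blast
qed


section \<open>Dual space, evaluations and weak topology\<close>

text \<open>Functionals are represented by functions on the ambient type; two of them that agree on \<open>E\<close>
  stand for the same element of the dual.\<close>

definition dual ::
  "('a \<Rightarrow> complex) set \<Rightarrow> (('a \<Rightarrow> complex) \<Rightarrow> real) \<Rightarrow> (('a \<Rightarrow> complex) \<Rightarrow> complex) set" where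
  "dual E N = {u.
     (\<forall>f\<in>E. \<forall>g\<in>E. u (f + g) = u f + u g) \<and>
     (\<forall>c. \<forall>f\<in>E. u (cscale c f) = c * u f) \<and>
     continuous_map (norm_topology E N) euclidean u}"

definition eval_at :: "'a \<Rightarrow> ('a \<Rightarrow> complex) \<Rightarrow> complex" where
  "eval_at x f = f x"

text \<open>Linear independence of the family of evaluations indexed by the points \<open>x\<close>; in particular
  distinct points have distinct evaluations. A combination vanishes in the dual when it
  vanishes on \<open>E\<close>.\<close>

definition evaluations_independent :: "('a \<Rightarrow> complex) set \<Rightarrow> bool" where
  "evaluations_independent E \<longleftrightarrow>
     (\<forall>F c. finite F \<longrightarrow> (\<forall>f\<in>E. (\<Sum>x\<in>F. c x * eval_at x f) = 0) \<longrightarrow> (\<forall>x\<in>F. c x = (0::complex)))"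

definition weak_topology ::
  "('a \<Rightarrow> complex) set \<Rightarrow> (('a \<Rightarrow> complex) \<Rightarrow> real) \<Rightarrow> ('a \<Rightarrow> complex) topology" where
  "weak_topology E N =
     topology_generated_by {{f \<in> E. u f \<in> U} | u U. u \<in> dual E N \<and> open U}"

lemma topspace_weak_topology: "topspace (weak_topology E N) = E"
proof -
  have "(\<lambda>_. 0) \<in> dual E N"
    by (simp add: dual_def)
  then have "E \<in> {{f \<in> E. u f \<in> U} | u U. u \<in> dual E N \<and> open U}"
    by (intro CollectI exI[of _ "\<lambda>_. 0"] exI[of _ UNIV]) auto
  then show ?thesis
    unfolding weak_topology_def topology_generated_by_topspace by auto
qed


section \<open>Weighted composition operators and weak supercyclicity\<close>

definition wcomp :: "('a \<Rightarrow> complex) \<Rightarrow> ('a \<Rightarrow> 'a) \<Rightarrow> ('a \<Rightarrow> complex) \<Rightarrow> ('a \<Rightarrow> complex)" where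
  "wcomp w \<phi> f = (\<lambda>x. w x * f (\<phi> x))"

definition weakly_supercyclic ::
  "('a \<Rightarrow> complex) set \<Rightarrow> (('a \<Rightarrow> complex) \<Rightarrow> real) \<Rightarrow>
   (('a \<Rightarrow> complex) \<Rightarrow> ('a \<Rightarrow> complex)) \<Rightarrow> bool" where
  "weakly_supercyclic E N T \<longleftrightarrow>
     (\<exists>f\<in>E. weak_topology E N closure_of {cscale c ((T ^^ n) f) | c n. True} = E)"

end

theory Submission
  imports Defs
begin

text \<open>
  Let \<open>T\<close> be the operator and \<open>f\<close> a weakly supercyclic vector. If functionals \<open>u\<close>, \<open>v\<close> satisfy
  \<open>|u (T\<^sup>n f)| \<le> K |v (T\<^sup>n f)|\<close> for all \<open>n\<close>, then the same bound holds on all of \<open>E\<close>, so \<open>u\<close> is a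
  multiple of \<open>v\<close>. Applied to two evaluations this shows that \<open>w\<close> has no zeros, that \<open>\<phi>\<close> is not the
  identity, and that every point \<open>x\<close> with \<open>\<phi> x \<noteq> x\<close> has an infinite orbit. By Hahn-Banach the linear
  span of the orbit of \<open>f\<close> is norm dense, so some \<open>F = p(T) f\<close> is uniformly close to the given
  nowhere vanishing function and thus has no zeros itself. By compactness \<open>|T F| \<le> C |F|\<close>, which
  bounds \<open>\<delta>\<^sub>x p(T) T\<close> by \<open>\<delta>\<^sub>x p(T)\<close> along the orbit of \<open>f\<close>. Hence these two functionals are
  proportional. As the points \<open>\<phi>\<^sup>k x\<close> are distinct, independence of the evaluations forces \<open>p = 0\<close>,
  a contradiction.
\<close>

section \<open>The Hahn-Banach theorem for sublinear functionals\<close>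

text \<open>Homogeneity is an inequality for positive \<open>t\<close>, a form that passes easily to
  infima; using it for \<open>1/t\<close> as well gives equality. Negative values are allowed, so
  real-linear functionals qualify.\<close>

definition sublinear_on :: "('a \<Rightarrow> complex) set \<Rightarrow> (('a \<Rightarrow> complex) \<Rightarrow> real) \<Rightarrow> bool" where
  "sublinear_on E s \<longleftrightarrow>
     (\<forall>h\<in>E. \<forall>k\<in>E. s (h + k) \<le> s h + s k) \<and>
     (\<forall>t>0. \<forall>h\<in>E. s (cscale (of_real t) h) \<le> t * s h)"

lemma sublinear_onD:
  assumes "sublinear_on E s"
  shows "h \<in> E \<Longrightarrow> k \<in> E \<Longrightarrow> s (h + k) \<le> s h + s k"
    and "0 < t \<Longrightarrow> h \<in> E \<Longrightarrow> s (cscale (of_real t) h) \<le> t * s h"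
  using assms by (auto simp: sublinear_on_def)

lemma sublinear_on_scale:
  assumes E: "cfun.subspace E" and s: "sublinear_on E s" and "0 < t" "h \<in> E"
  shows "s (cscale (of_real t) h) = t * s h"
proof (rule antisym)
  have "s h = s (cscale (of_real (inverse t)) (cscale (of_real t) h))"
    using \<open>0 < t\<close> by (simp flip: of_real_mult)
  also have "\<dots> \<le> inverse t * s (cscale (of_real t) h)"
    using assms by (intro sublinear_onD(2)[OF s] cfun.subspace_scale[OF E]) auto
  finally show "t * s h \<le> s (cscale (of_real t) h)"
    using \<open>0 < t\<close> by (simp add: field_simps)
qed (use assms sublinear_onD(2) in blast)

lemma sublinear_on_zero:
  assumes E: "cfun.subspace E" and s: "sublinear_on E s"
  shows "s 0 = 0"
  using sublinear_on_scale[OF E s, of 2 0] cfun.subspace_0[OF E] by simp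

text \<open>The infimal convolution of \<open>s\<close> with a convex cone \<open>K\<close> of constraints \<open>(k, r)\<close>. It lies below
  \<open>s\<close>, and every linear functional below it is at least \<open>r\<close> at \<open>k\<close>.\<close>

lemma sublinear_on_reduce:
  assumes E: "cfun.subspace E" and s: "sublinear_on E s"
    and K0: "(0, 0) \<in> K"
    and KE: "\<And>k r. (k, r) \<in> K \<Longrightarrow> k \<in> E"
    and Kadd: "\<And>k r k' r'. (k, r) \<in> K \<Longrightarrow> (k', r') \<in> K \<Longrightarrow> (k + k', r + r') \<in> K"
    and Kscale: "\<And>k r t. (k, r) \<in> K \<Longrightarrow> 0 < t \<Longrightarrow> (cscale (of_real t) k, t * r) \<in> K"
    and Kle: "\<And>k r. (k, r) \<in> K \<Longrightarrow> r \<le> s k"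
  obtains s' where "sublinear_on E s'" "\<And>h. h \<in> E \<Longrightarrow> s' h \<le> s h"
    "\<And>k r. (k, r) \<in> K \<Longrightarrow> s' (- k) \<le> - r"
proof -
  define F where "F h = (\<lambda>(k, r). s (h + k) - r)" for h
  define s' where "s' h = (INF p\<in>K. F h p)" for h
  note add = cfun.subspace_add[OF E] and neg = cfun.subspace_neg[OF E]
    and scale = cfun.subspace_scale[OF E]
  \<comment> \<open>Subadditivity at \<open>k = (h + k) + (- h)\<close> together with
    \<open>r \<le> s k\<close> keeps the infimum defining \<open>s'\<close> finite.\<close>
  have lower: "- s (- h) \<le> F h (k, r)" if "h \<in> E" "(k, r) \<in> K" for h k r
    using sublinear_onD(1)[OF s add[OF that(1) KE[OF that(2)]] neg[OF that(1)]] Kle[OF that(2)]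
    by (simp add: F_def)
  have bdd: "bdd_below (F h ` K)" if "h \<in> E" for h
    using lower[OF that] by (intro bdd_belowI[of _ "- s (- h)"]) auto
  have le: "s' h \<le> s (h + k) - r" if "h \<in> E" "(k, r) \<in> K" for h k r
    using cINF_lower[OF bdd[OF that(1)] that(2)] by (simp add: s'_def F_def)
  have ge: "b \<le> s' h" if "\<And>k r. (k, r) \<in> K \<Longrightarrow> b \<le> s (h + k) - r" for b h
    unfolding s'_def using K0 that by (intro cINF_greatest) (auto simp: F_def)
  have "s' (h + h') \<le> s' h + s' h'" if h: "h \<in> E" "h' \<in> E" for h h'
  proof -
    have *: "s' (h + h') \<le> (s (h + k) - r) + (s (h' + k') - r')"
      if k: "(k, r) \<in> K" "(k', r') \<in> K" for k r k' r'
    proof -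
      have "s' (h + h') \<le> s ((h + h') + (k + k')) - (r + r')"
        by (intro le add h Kadd k)
      also have "(h + h') + (k + k') = (h + k) + (h' + k')" by (simp add: algebra_simps)
      also have "s \<dots> \<le> s (h + k) + s (h' + k')"
        by (intro sublinear_onD(1)[OF s] add h KE[OF k(1)] KE[OF k(2)])
      finally show ?thesis by linarith
    qed
    \<comment> \<open>One infimum at a time: first over \<open>(k', r')\<close>, then over
      \<open>(k, r)\<close>.\<close>
    have "s' (h + h') - (s (h + k) - r) \<le> s' h'" if k: "(k, r) \<in> K" for k r
    proof (rule ge)
      show "s' (h + h') - (s (h + k) - r) \<le> s (h' + k') - r'" if "(k', r') \<in> K" for k' r'
        using *[OF k that] by linarith
    qed
    then have "s' (h + h') - s' h' \<le> s' h"
      by (intro ge) (simp add: algebra_simps)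
    then show ?thesis by simp
  qed
  moreover have "s' (cscale (of_real t) h) \<le> t * s' h" if t: "0 < t" and h: "h \<in> E" for t h
  proof -
    have "s' (cscale (of_real t) h) / t \<le> s' h"
    proof (rule ge)
      fix k r assume k: "(k, r) \<in> K"
      have "s' (cscale (of_real t) h) \<le> s (cscale (of_real t) h + cscale (of_real t) k) - t * r"
        by (intro le scale h Kscale k t)
      also have "\<dots> = t * s (h + k) - t * r"
        using sublinear_on_scale[OF E s t add[OF h KE[OF k]]] by (simp add: cfun.scale_right_distrib)
      finally show "s' (cscale (of_real t) h) / t \<le> s (h + k) - r"
        using t by (simp add: field_simps)
    qed
    then show ?thesis using t by (simp add: field_simps)
  qed
  ultimately have "sublinear_on E s'" by (simp add: sublinear_on_def)
  moreover have "s' h \<le> s h" if "h \<in> E" for h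
    using le[OF that K0] by simp
  moreover have "s' (- k) \<le> - r" if "(k, r) \<in> K" for k r
    using le[OF neg[OF KE[OF that]] that] sublinear_on_zero[OF E s] by simp
  ultimately show thesis by (rule that)
qed

text \<open>Zorn's lemma for the sublinear functionals below \<open>p\<close>. A nonempty chain is
  bounded by its pointwise infimum, which is finite because \<open>- p (- h) \<le> s h\<close> for
  every such \<open>s\<close>.\<close>

lemma minimal_sublinear_exists:
  assumes E: "cfun.subspace E" and p: "sublinear_on E p"
  obtains s where "sublinear_on E s" "\<And>h. h \<in> E \<Longrightarrow> s h \<le> p h"
    "\<And>s' h. sublinear_on E s' \<Longrightarrow> (\<And>k. k \<in> E \<Longrightarrow> s' k \<le> s k) \<Longrightarrow> h \<in> E \<Longrightarrow> s' h = s h"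
proof -
  note add = cfun.subspace_add[OF E] and neg = cfun.subspace_neg[OF E]
    and scale = cfun.subspace_scale[OF E]
  \<comment> \<open>The value 0 outside \<open>E\<close> turns comparison on \<open>E\<close> into
    comparison of functions. \<open>R\<close> is the reversed order, since
    \<open>predicate_Zorn\<close> yields maximal elements.\<close>
  define A where "A = {s. sublinear_on E s \<and> (\<forall>h. h \<notin> E \<longrightarrow> s h = 0) \<and> (\<forall>h\<in>E. s h \<le> p h)}"
  define R where "R = (\<lambda>a b :: ('a \<Rightarrow> complex) \<Rightarrow> real. b \<le> a)"
  have cut: "sublinear_on E (\<lambda>h. if h \<in> E then s h else 0)" if "sublinear_on E s" for s
    using that add scale by (simp add: sublinear_on_def)
  have lower: "- p (- h) \<le> s h" if "s \<in> A" "h \<in> E" for s h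
  proof -
    have "sublinear_on E s" using that by (simp add: A_def)
    then have "0 \<le> s h + s (- h)"
      using sublinear_onD(1)[of E s h "- h"] sublinear_on_zero[OF E, of s] that neg by simp
    moreover have "s (- h) \<le> p (- h)"
      using that neg by (simp add: A_def)
    ultimately show ?thesis by simp
  qed
  have "\<exists>m\<in>A. \<forall>a\<in>A. R m a \<longrightarrow> a = m"
  proof (rule predicate_Zorn)
    show "partial_order_on A (relation_of R A)"
      by (intro partial_order_on_relation_ofI) (auto simp: R_def)
    fix C assume C: "C \<in> Chains (relation_of R A)"
    have chain: "a \<le> b \<or> b \<le> a" if "a \<in> C" "b \<in> C" for a b
      using C that by (auto simp: Chains_def relation_of_def R_def)
    have CA: "C \<subseteq> A"
      by (rule Chains_relation_of[OF C])
    show "\<exists>u\<in>A. \<forall>a\<in>C. R a u"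
    proof (cases "C = {}")
      case True
      with cut[OF p] show ?thesis by (auto simp: A_def)
    next
      case False
      define u where "u h = (INF s\<in>C. s h)" for h
      have bdd: "bdd_below ((\<lambda>s. s h) ` C)" if "h \<in> E" for h
        using lower that CA by (intro bdd_belowI[of _ "- p (- h)"]) auto
      have le: "u h \<le> s h" if "s \<in> C" "h \<in> E" for s h
        unfolding u_def by (rule cINF_lower[OF bdd[OF that(2)] that(1)])
      have ge: "b \<le> u h" if "\<And>s. s \<in> C \<Longrightarrow> b \<le> s h" for b h
        unfolding u_def using False that by (intro cINF_greatest)
      have sub: "sublinear_on E s" if "s \<in> C" for s
        using that CA by (auto simp: A_def)
      have "u (h + k) \<le> u h + u k" if h: "h \<in> E" "k \<in> E" for h k
      proof -
        \<comment> \<open>Of two members of a chain, the smaller one serves for both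
          summands.\<close>
        have *: "u (h + k) \<le> a h + b k" if ab: "a \<in> C" "b \<in> C" for a b
          using chain[OF ab]
        proof
          assume "a \<le> b"
          have "u (h + k) \<le> a h + a k"
            using le[OF ab(1) add[OF h]] sublinear_onD(1)[OF sub[OF ab(1)] h] by simp
          with le_funD[OF \<open>a \<le> b\<close>, of k] show ?thesis by simp
        next
          assume "b \<le> a"
          have "u (h + k) \<le> b h + b k"
            using le[OF ab(2) add[OF h]] sublinear_onD(1)[OF sub[OF ab(2)] h] by simp
          with le_funD[OF \<open>b \<le> a\<close>, of h] show ?thesis by simp
        qed
        have "u (h + k) - a h \<le> u k" if "a \<in> C" for a
          using *[OF that] by (intro ge) (simp add: diff_le_eq add.commute)
        then have "u (h + k) - u k \<le> u h"
          by (intro ge) (simp add: algebra_simps)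
        then show ?thesis by simp
      qed
      moreover have "u (cscale (of_real t) h) \<le> t * u h" if t: "0 < t" and h: "h \<in> E" for t h
      proof -
        have "u (cscale (of_real t) h) / t \<le> u h"
        proof (rule ge)
          fix a assume a: "a \<in> C"
          show "u (cscale (of_real t) h) / t \<le> a h"
            using le[OF a scale[OF h]] sublinear_onD(2)[OF sub[OF a] t h] t
            by (simp add: field_simps) (meson order_trans)
        qed
        then show ?thesis using t by (simp add: field_simps)
      qed
      ultimately have "sublinear_on E u" by (simp add: sublinear_on_def)
      moreover have "u h \<le> p h" if "h \<in> E" for h
      proof -
        obtain a where "a \<in> C" using False by blast
        with le[OF this that] CA that show ?thesis by (force simp: A_def)
      qed
      ultimately have "(\<lambda>h. if h \<in> E then u h else 0) \<in> A"
        using cut by (simp add: A_def)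
      moreover have "R a (\<lambda>h. if h \<in> E then u h else 0)" if "a \<in> C" for a
        using that le[OF that] CA by (auto simp: R_def le_fun_def A_def)
      ultimately show ?thesis by blast
    qed
  qed
  then obtain s where s: "s \<in> A" and min: "\<And>a. a \<in> A \<Longrightarrow> a \<le> s \<Longrightarrow> a = s"
    by (auto simp: R_def)
  show thesis
  proof (rule that)
    show "sublinear_on E s" "h \<in> E \<Longrightarrow> s h \<le> p h" for h
      using s by (auto simp: A_def)
    fix s' h assume s': "sublinear_on E s'" "\<And>k. k \<in> E \<Longrightarrow> s' k \<le> s k" and h: "h \<in> E"
    have "(\<lambda>h. if h \<in> E then s' h else 0) = s"
    proof (rule min)
      show "(\<lambda>h. if h \<in> E then s' h else 0) \<in> A"
        using s s' cut[OF s'(1)] by (force simp: A_def)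
      show "(\<lambda>h. if h \<in> E then s' h else 0) \<le> s"
        using s s' by (auto simp: le_fun_def A_def)
    qed
    from fun_cong[OF this, of h] h show "s' h = s h" by simp
  qed
qed

text \<open>A minimal sublinear functional is linear: reducing it along a ray must leave it unchanged.\<close>

lemma Hahn_Banach_sublinear:
  assumes E: "cfun.subspace E" and p: "sublinear_on E p"
  obtains s where "\<And>h. h \<in> E \<Longrightarrow> s h \<le> p h"
    "\<And>h k. h \<in> E \<Longrightarrow> k \<in> E \<Longrightarrow> s (h + k) = s h + s k"
    "\<And>t h. h \<in> E \<Longrightarrow> s (cscale (of_real t) h) = t * s h"
proof -
  note add = cfun.subspace_add[OF E] and neg = cfun.subspace_neg[OF E]
    and scale = cfun.subspace_scale[OF E]
  obtain s where s: "sublinear_on E s" and le: "\<And>h. h \<in> E \<Longrightarrow> s h \<le> p h"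
    and min: "\<And>s' h. sublinear_on E s' \<Longrightarrow> (\<And>k. k \<in> E \<Longrightarrow> s' k \<le> s k) \<Longrightarrow> h \<in> E \<Longrightarrow> s' h = s h"
    using minimal_sublinear_exists[OF E p] by blast
  have s0: "s 0 = 0" by (rule sublinear_on_zero[OF E s])
  have minus: "s (- v) = - s v" if v: "v \<in> E" for v
  proof (rule antisym)
    \<comment> \<open>The constraints are the values of \<open>s\<close> itself on the ray through
      \<open>v\<close>. The reduced functional lies below \<open>s\<close>, so by minimality it
      agrees with \<open>s\<close> on \<open>E\<close>.\<close>
    define K where "K = {(cscale (of_real t) v, t * s v) | t. 0 \<le> t}"
    obtain s' where s': "sublinear_on E s'" "\<And>h. h \<in> E \<Longrightarrow> s' h \<le> s h"
      "\<And>k r. (k, r) \<in> K \<Longrightarrow> s' (- k) \<le> - r"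
    proof (rule sublinear_on_reduce[OF E s])
      show "(0, 0) \<in> K"
        unfolding K_def by (intro CollectI exI[of _ 0]) simp
      show "k \<in> E" if "(k, r) \<in> K" for k r
        using that scale[OF v] by (auto simp: K_def)
      show "(k + k', r + r') \<in> K" if "(k, r) \<in> K" "(k', r') \<in> K" for k r k' r'
      proof -
        from that obtain t t' where "0 \<le> t" "0 \<le> t'" and
          eq: "k = cscale (of_real t) v" "r = t * s v" "k' = cscale (of_real t') v" "r' = t' * s v"
          by (auto simp: K_def)
        then show ?thesis
          unfolding K_def
          by (intro CollectI exI[of _ "t + t'"]) (simp add: cfun.scale_left_distrib algebra_simps)
      qed
      show "(cscale (of_real t) k, t * r) \<in> K" if "(k, r) \<in> K" "0 < t" for k r t
      proof -
        from that obtain t' where "0 \<le> t'" "k = cscale (of_real t') v" "r = t' * s v"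
          by (auto simp: K_def)
        then show ?thesis
          unfolding K_def using \<open>0 < t\<close> by (intro CollectI exI[of _ "t * t'"]) simp
      qed
      show "r \<le> s k" if "(k, r) \<in> K" for k r
      proof -
        from that obtain t where t: "0 \<le> t" "k = cscale (of_real t) v" "r = t * s v"
          by (auto simp: K_def)
        then show ?thesis
          using sublinear_on_scale[OF E s _ v, of t] s0 by (cases "t = 0") auto
      qed
    qed blast
    have "(v, s v) \<in> K"
      unfolding K_def by (intro CollectI exI[of _ 1]) simp
    then have "s' (- v) \<le> - s v" by (rule s'(3))
    then show "s (- v) \<le> - s v" using min[OF s'(1,2) neg[OF v]] by simp
    show "- s v \<le> s (- v)"
      using sublinear_onD(1)[OF s v neg[OF v]] s0 by simp
  qed
  show thesis
  proof (rule that)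
    show "s h \<le> p h" if "h \<in> E" for h
      by (rule le[OF that])
    \<comment> \<open>The reverse inequality is subadditivity at
      \<open>h = (h + k) + (- k)\<close>.\<close>
    show "s (h + k) = s h + s k" if "h \<in> E" "k \<in> E" for h k
      using sublinear_onD(1)[OF s that] sublinear_onD(1)[OF s add[OF that] neg[OF that(2)]]
        minus[OF that(2)] by simp
    show "s (cscale (of_real t) h) = t * s h" if h: "h \<in> E" for t h
    proof -
      consider "t = 0" | "0 < t" | "0 < - t" by linarith
      then show ?thesis
      proof cases
        case 3
        have "s (- cscale (of_real t) h) = (- t) * s h"
          using sublinear_on_scale[OF E s 3 h] by simp
        then show ?thesis using minus[OF scale[OF h, of "of_real t"]] by simp
      qed (use s0 sublinear_on_scale[OF E s _ h] in auto)
    qed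
  qed
qed


section \<open>Continuous functionals and weakly dense orbits\<close>

lemma dualD:
  assumes "u \<in> dual E N"
  shows "f \<in> E \<Longrightarrow> g \<in> E \<Longrightarrow> u (f + g) = u f + u g"
    and "f \<in> E \<Longrightarrow> u (cscale c f) = c * u f"
    and "continuous_map (norm_topology E N) euclidean u"
  using assms by (auto simp: dual_def)

lemma norm_minus:
  assumes E: "cfun.subspace E" and N: "norm_on E N" and h: "h \<in> E"
  shows "N (- h) = N h"
  using norm_onD(3)[OF N h, of "-1"] by simp

lemma dualI_bounded:
  assumes E: "cfun.subspace E" and N: "norm_on E N"
    and add: "\<And>f g. f \<in> E \<Longrightarrow> g \<in> E \<Longrightarrow> u (f + g) = u f + u g"
    and scale: "\<And>c f. f \<in> E \<Longrightarrow> u (cscale c f) = c * u f"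
    and bound: "\<And>f. f \<in> E \<Longrightarrow> cmod (u f) \<le> C * N f"
  shows "u \<in> dual E N"
proof -
  note diff = cfun.subspace_diff[OF E]
  have udiff: "u (f - g) = u f - u g" if "f \<in> E" "g \<in> E" for f g
    using add[OF diff[OF that] that(2)] by simp
  interpret M: Metric_space E "norm_dist E N"
    by (rule Metric_space_norm_dist[OF E N])
  have "continuous_map M.mtopology (Metric_space.mtopology UNIV dist) u"
    unfolding M.metric_continuous_map[OF Met_TC.Metric_space_axioms]
  proof (intro conjI ballI allI impI)
    fix f and e :: real assume f: "f \<in> E" and e: "0 < e"
    \<comment> \<open>Positive even if \<open>C\<close> is not, so that \<open>e / D\<close> is a
      valid radius.\<close>
    define D where "D = \<bar>C\<bar> + 1"
    have D: "D > 0" by (simp add: D_def)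
    have "dist (u f) (u g) < e" if g: "g \<in> E" "norm_dist E N f g < e / D" for g
    proof -
      have "dist (u f) (u g) \<le> C * N (f - g)"
        using bound[OF diff[OF f g(1)]] udiff[OF f g(1)] by (simp add: dist_norm)
      also have "\<dots> \<le> D * N (f - g)"
        using norm_onD(1)[OF N diff[OF f g(1)]] by (intro mult_right_mono) (auto simp: D_def)
      also have "\<dots> < e"
        using g f D by (simp add: norm_dist_def field_simps)
      finally show ?thesis .
    qed
    then show "\<exists>\<delta>>0. \<forall>g. g \<in> E \<and> norm_dist E N f g < \<delta> \<longrightarrow> dist (u f) (u g) < e"
      using e D by (intro exI[of _ "e / D"]) auto
  qed auto
  then show ?thesis
    using add scale by (simp add: dual_def norm_topology_def)
qed

text \<open>Complex Hahn-Banach separation. Reducing \<open>N\<close> by the constraints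
  \<open>(t g + m, t d)\<close> yields a real-linear \<open>s\<close> below \<open>N\<close> with
  \<open>s = 0\<close> on \<open>M\<close> and \<open>s g \<ge> d\<close>; \<open>s\<close> is then
  the real part of the required functional.\<close>

lemma dual_separation:
  assumes E: "cfun.subspace E" and N: "norm_on E N"
    and M: "cfun.subspace M" "M \<subseteq> E" and g: "g \<in> E"
    and d: "0 < d" "\<And>m. m \<in> M \<Longrightarrow> d \<le> N (g - m)"
  obtains u where "u \<in> dual E N" "\<And>m. m \<in> M \<Longrightarrow> u m = 0" "u g \<noteq> 0"
proof -
  note add = cfun.subspace_add[OF E] and neg = cfun.subspace_neg[OF E]
    and scale = cfun.subspace_scale[OF E]
  have ME: "m \<in> E" if "m \<in> M" for m using M(2) that by blast
  have N_sub: "sublinear_on E N"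
    using norm_onD(3,4)[OF N] by (simp add: sublinear_on_def)
  have N0: "N 0 = 0"
    by (rule sublinear_on_zero[OF E N_sub])
  define K where "K = {(cscale (of_real t) g + m, t * d) | t m. 0 \<le> t \<and> m \<in> M}"
  have KI: "(cscale (of_real t) g + m, t * d) \<in> K" if "0 \<le> t" "m \<in> M" for t m
    using that by (auto simp: K_def)
  have KE: "\<exists>t m. k = cscale (of_real t) g + m \<and> r = t * d \<and> 0 \<le> t \<and> m \<in> M"
    if "(k, r) \<in> K" for k r
    using that by (auto simp: K_def)
  obtain p where p: "sublinear_on E p" "\<And>h. h \<in> E \<Longrightarrow> p h \<le> N h"
    "\<And>k r. (k, r) \<in> K \<Longrightarrow> p (- k) \<le> - r"
  proof (rule sublinear_on_reduce[OF E N_sub])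
    show "(0, 0) \<in> K"
      using KI[of 0 0] cfun.subspace_0[OF M(1)] by simp
    show "k \<in> E" if "(k, r) \<in> K" for k r
      using KE[OF that] ME add scale[OF g] by blast
    show "(k + k', r + r') \<in> K" if k: "(k, r) \<in> K" "(k', r') \<in> K" for k r k' r'
    proof -
      obtain t m t' m' where eq: "k = cscale (of_real t) g + m" "r = t * d"
        "k' = cscale (of_real t') g + m'" "r' = t' * d" and "0 \<le> t" "m \<in> M" "0 \<le> t'" "m' \<in> M"
        using KE[OF k(1)] KE[OF k(2)] by blast
      then have "(cscale (of_real (t + t')) g + (m + m'), (t + t') * d) \<in> K"
        by (intro KI cfun.subspace_add[OF M(1)]) auto
      then show ?thesis
        unfolding eq by (simp only: of_real_add cfun.scale_left_distrib distrib_right add.assoc add.left_commute)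
    qed
    show "(cscale (of_real t) k, t * r) \<in> K" if k: "(k, r) \<in> K" "0 < t" for k r t
    proof -
      obtain t' m where eq: "k = cscale (of_real t') g + m" "r = t' * d" and "0 \<le> t'" "m \<in> M"
        using KE[OF k(1)] by blast
      then have "(cscale (of_real (t * t')) g + cscale (of_real t) m, (t * t') * d) \<in> K"
        using k(2) by (intro KI cfun.subspace_scale[OF M(1)]) auto
      then show ?thesis
        unfolding eq by (simp only: of_real_mult cfun.scale_right_distrib cfun.scale_scale mult.assoc)
    qed
    show "r \<le> N k" if k: "(k, r) \<in> K" for k r
    proof -
      obtain t m where eq: "k = cscale (of_real t) g + m" "r = t * d" and t: "0 \<le> t" and m: "m \<in> M"
        using KE[OF k] by blast
      show ?thesis
      proof (cases "t = 0")
        case True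
        then show ?thesis using eq norm_onD(1)[OF N ME[OF m]] by simp
      next
        case False
        \<comment> \<open>For \<open>t > 0\<close>, \<open>t g + m = t (g - m')\<close> with
          \<open>m' = - m / t\<close> in \<open>M\<close>, so the distance assumption
          applies.\<close>
        define m' where "m' = cscale (of_real (- inverse t)) m"
        have m': "m' \<in> M" unfolding m'_def by (rule cfun.subspace_scale[OF M(1) m])
        have "cscale (of_real t) m' = - m"
          using False by (simp add: m'_def flip: of_real_mult)
        then have "k = cscale (of_real t) (g - m')"
          by (simp only: eq cfun.scale_right_diff_distrib diff_minus_eq_add)
        then have "N k = t * N (g - m')"
          using norm_onD(3)[OF N cfun.subspace_diff[OF E g ME[OF m']], of "of_real t"] t by simp
        then show ?thesis
          using mult_left_mono[OF d(2)[OF m'] t] eq by simp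
      qed
    qed
  qed blast
  obtain s where s: "\<And>h. h \<in> E \<Longrightarrow> s h \<le> p h"
    and s_add: "\<And>h k. h \<in> E \<Longrightarrow> k \<in> E \<Longrightarrow> s (h + k) = s h + s k"
    and s_scale: "\<And>t h. h \<in> E \<Longrightarrow> s (cscale (of_real t) h) = t * s h"
    using Hahn_Banach_sublinear[OF E p(1)] by blast
  have s_neg: "s (- h) = - s h" if "h \<in> E" for h
    using s_scale[OF that, of "-1"] by simp
  have sN: "\<bar>s h\<bar> \<le> N h" if "h \<in> E" for h
    using s[OF that] p(2)[OF that] s[OF neg[OF that]] p(2)[OF neg[OF that]]
      norm_minus[OF E N that] s_neg[OF that] by linarith
  have sM: "s m = 0" if m: "m \<in> M" for m
  proof -
    have "- s m \<le> 0" if "m \<in> M" for m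
      using s[OF neg[OF ME[OF that]]] p(3)[OF KI[of 0 m]] that s_neg[OF ME[OF that]] by simp
    from this[OF m] this[OF cfun.subspace_neg[OF M(1) m]] show ?thesis
      using s_neg[OF ME[OF m]] by simp
  qed
  have sg: "d \<le> s g"
    using s[OF neg[OF g]] p(3)[OF KI[of 1 0]] cfun.subspace_0[OF M(1)] s_neg[OF g] by simp
  \<comment> \<open>The complex-linear functional with real part \<open>s\<close>, that is
    \<open>s h - i s (i h)\<close>.\<close>
  define u where "u h = Complex (s h) (- s (cscale \<i> h))" for h
  have iE: "cscale \<i> h \<in> E" if "h \<in> E" for h by (rule scale[OF that])
  show thesis
  proof (rule that)
    show "u \<in> dual E N"
    proof (rule dualI_bounded[OF E N, of _ 2])
      show "u (h + k) = u h + u k" if "h \<in> E" "k \<in> E" for h k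
        using that iE by (simp only: u_def cfun.scale_right_distrib s_add complex_add minus_add_distrib)
      show "u (cscale c h) = c * u h" if h: "h \<in> E" for c h
      proof -
        have c: "c = of_real (Re c) + of_real (Im c) * \<i>"
          by (simp add: complex_eq_iff)
        have "cscale c h = cscale (of_real (Re c)) h + cscale (of_real (Im c)) (cscale \<i> h)"
          by (subst c) (simp only: cfun.scale_left_distrib cfun.scale_scale)
        then have 1: "s (cscale c h) = Re c * s h + Im c * s (cscale \<i> h)"
          using h by (simp only: s_add s_scale iE scale)
        have ci: "\<i> * c = of_real (Re c) * \<i> + of_real (- Im c)"
          by (simp add: complex_eq_iff)
        have "cscale \<i> (cscale c h) = cscale (of_real (Re c)) (cscale \<i> h) + cscale (of_real (- Im c)) h"
          by (simp only: cfun.scale_scale ci cfun.scale_left_distrib)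
        then have 2: "s (cscale \<i> (cscale c h)) = Re c * s (cscale \<i> h) - Im c * s h"
          using h by (simp only: s_add s_scale iE scale)
        show ?thesis
          unfolding u_def 1 2 by (simp add: complex_eq_iff algebra_simps)
      qed
      show "cmod (u h) \<le> 2 * N h" if h: "h \<in> E" for h
        using cmod_le[of "u h"] sN[OF h] sN[OF iE[OF h]] norm_onD(3)[OF N h, of \<i>]
        by (simp add: u_def)
    qed
    show "u m = 0" if "m \<in> M" for m
      using sM[OF that] sM[OF cfun.subspace_scale[OF M(1) that, of \<i>]]
      by (simp add: u_def complex_eq_iff)
    show "u g \<noteq> 0"
      using sg d(1) by (simp add: u_def complex_eq_iff)
  qed
qed

section \<open>Operations on the dual and continuity of evaluations\<close>

lemma dual_zero: "(\<lambda>_. 0) \<in> dual E N"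
  by (simp add: dual_def)

lemma dual_add: "u \<in> dual E N \<Longrightarrow> v \<in> dual E N \<Longrightarrow> (\<lambda>f. u f + v f) \<in> dual E N"
  by (auto simp: dual_def algebra_simps intro: continuous_map_add)

lemma dual_scale: "u \<in> dual E N \<Longrightarrow> (\<lambda>f. c * u f) \<in> dual E N"
  using continuous_map_compose[of _ euclidean u euclidean "(*) c"]
  by (auto simp: dual_def o_def distrib_left mult.left_commute continuous_on_mult_left)

lemma dual_sum: "(\<And>i. i \<in> I \<Longrightarrow> u i \<in> dual E N) \<Longrightarrow> (\<lambda>f. \<Sum>i\<in>I. u i f) \<in> dual E N"
  by (induction I rule: infinite_finite_induct) (auto intro: dual_zero dual_add)

lemma cmod_le_sup_norm:
  fixes f :: "'a::topological_space \<Rightarrow> complex"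
  assumes "compact (UNIV :: 'a set)" "f \<in> cont_funs"
  shows "cmod (f x) \<le> sup_norm f"
  unfolding sup_norm_def
proof (rule cSUP_upper)
  show "bdd_above (range (\<lambda>x. cmod (f x)))"
    using assms by (intro bounded_imp_bdd_above compact_imp_bounded compact_continuous_image)
      (auto simp: cont_funs_def intro!: continuous_intros)
qed simp

text \<open>Evaluations have bound 1 for the supremum norm; continuity on \<open>E\<close> comes by
  composing with the inclusion.\<close>

lemma eval_at_dual:
  fixes E :: "('a::topological_space \<Rightarrow> complex) set"
  assumes comp: "compact (UNIV :: 'a set)"
    and cont: "continuous_map (norm_topology E N) (norm_topology cont_funs sup_norm) (\<lambda>f. f)"
  shows "eval_at x \<in> dual E N"
proof -
  have "eval_at x \<in> dual cont_funs sup_norm"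
    by (rule dualI_bounded[OF subspace_cont_funs norm_on_cont_funs[OF comp], of _ 1])
      (auto simp: eval_at_def cscale_def cmod_le_sup_norm[OF comp])
  then have "continuous_map (norm_topology cont_funs sup_norm) euclidean (eval_at x)"
    by (rule dualD(3))
  from continuous_map_compose[OF cont this] show ?thesis
    by (simp add: dual_def o_def eval_at_def[abs_def] cscale_def)
qed

lemma continuous_map_weak_topology:
  assumes "u \<in> dual E N"
  shows "continuous_map (weak_topology E N) euclidean u"
proof -
  have "openin (weak_topology E N) {f \<in> E. u f \<in> U}" if "open U" for U
    unfolding weak_topology_def using assms that by (intro topology_generated_by_Basis) blast
  then show ?thesis
    by (simp add: continuous_map topspace_weak_topology)
qed

text \<open>Closedness of the set of \<open>h\<close> with \<open>|u h| \<le> K |v h|\<close> passes the bound from the projective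
  orbit to all of \<open>E\<close>, where it forces \<open>ker v \<subseteq> ker u\<close>.\<close>

lemma weakly_dense_orbit_proportional:
  assumes E: "cfun.subspace E" and TE: "\<And>n. (T ^^ n) f \<in> E"
    and dense: "weak_topology E N closure_of {cscale c ((T ^^ n) f) | c n. True} = E"
    and u: "u \<in> dual E N" and v: "v \<in> dual E N"
    and bound: "\<And>n. cmod (u ((T ^^ n) f)) \<le> K * cmod (v ((T ^^ n) f))"
  obtains c where "\<And>h. h \<in> E \<Longrightarrow> u h = c * v h"
proof -
  let ?W = "weak_topology E N" and ?O = "{cscale c ((T ^^ n) f) | c n. True}"
  have "continuous_map ?W euclidean (\<lambda>h. K * cmod (v h) - cmod (u h))"
    using continuous_map_weak_topology[OF u] continuous_map_weak_topology[OF v]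
    by (intro continuous_map_diff continuous_map_real_mult continuous_map_norm) auto
  from closedin_continuous_map_preimage[OF this, of "{0..}"]
  have "closedin ?W {h \<in> E. cmod (u h) \<le> K * cmod (v h)}"
    by (simp add: topspace_weak_topology)
  moreover have "?O \<subseteq> {h \<in> E. cmod (u h) \<le> K * cmod (v h)}"
  proof clarify
    fix c n
    show "cscale c ((T ^^ n) f) \<in> E \<and>
        cmod (u (cscale c ((T ^^ n) f))) \<le> K * cmod (v (cscale c ((T ^^ n) f)))"
      using TE[of n] mult_left_mono[OF bound[of n], of "cmod c"]
      by (simp add: dualD(2)[OF u] dualD(2)[OF v] cfun.subspace_scale[OF E] norm_mult mult.left_commute)
  qed
  ultimately have le: "cmod (u h) \<le> K * cmod (v h)" if "h \<in> E" for h
    using closure_of_minimal[of ?O _ ?W] dense that by blast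
  show thesis
  proof (cases "\<exists>k\<in>E. v k \<noteq> 0")
    case True
    then obtain k where k: "k \<in> E" "v k \<noteq> 0" by blast
    have "u h = (u k / v k) * v h" if h: "h \<in> E" for h
    proof -
      \<comment> \<open>Adding this multiple of \<open>k\<close> moves \<open>h\<close> into the
        kernel of \<open>v\<close>.\<close>
      have kE: "cscale (- v h / v k) k \<in> E" by (rule cfun.subspace_scale[OF E k(1)])
      have "v (h + cscale (- v h / v k) k) = 0"
        unfolding dualD(1)[OF v h kE] dualD(2)[OF v k(1)] using k by simp
      then have "u (h + cscale (- v h / v k) k) = 0"
        using le[OF cfun.subspace_add[OF E h kE]] by simp
      then show ?thesis
        unfolding dualD(1)[OF u h kE] dualD(2)[OF u k(1)] by (simp add: field_simps)
    qed
    then show thesis by (rule that)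
  next
    case False
    then show thesis using le that[of 0] by force
  qed
qed

section \<open>Iterates and linear spans of orbits\<close>

lemma wcomp_funpow: "(wcomp w \<phi> ^^ n) f x = (\<Prod>k<n. w ((\<phi> ^^ k) x)) * f ((\<phi> ^^ n) x)"
proof (induction n arbitrary: x)
  case (Suc n)
  then show ?case
    by (simp add: wcomp_def prod.lessThan_Suc_shift funpow_swap1 del: prod.lessThan_Suc)
qed simp

lemma cscale_sum_apply: "(\<Sum>k\<in>I. cscale (c k) (g k)) x = (\<Sum>k\<in>I. c k * g k x)"
  by (induction I rule: infinite_finite_induct) (auto simp: cscale_def)

lemma bounded_below_nonvanishing:
  fixes g :: "'a::topological_space \<Rightarrow> complex"
  assumes "compact (UNIV :: 'a set)" "continuous_on UNIV g" "\<And>x. g x \<noteq> 0"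
  obtains e where "0 < e" "\<And>x. e \<le> cmod (g x)"
proof -
  have "continuous_on UNIV (\<lambda>x. cmod (g x))" by (intro continuous_intros assms)
  from continuous_attains_inf[OF assms(1) _ this]
  obtain a where "\<And>x. cmod (g a) \<le> cmod (g x)" by auto
  with assms(3)[of a] show thesis by (intro that[of "cmod (g a)"]) auto
qed

lemma orbit_span_eq:
  fixes T :: "('a \<Rightarrow> complex) \<Rightarrow> ('a \<Rightarrow> complex)"
  assumes "h \<in> cfun.span (range (\<lambda>n. (T ^^ n) f))"
  obtains c m where "h = (\<Sum>k<m. cscale (c k) ((T ^^ k) f))"
proof -
  \<comment> \<open>Strengthened by \<open>c k = 0\<close> from \<open>m\<close> on, so that sums of
    different lengths can be padded to a common length.\<close>
  have "\<exists>c m. h = (\<Sum>k<m. cscale (c k) ((T ^^ k) f)) \<and> (\<forall>k\<ge>m. c k = 0)"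
    using assms
  proof (induction rule: cfun.span_induct_alt)
    case base
    show ?case by (intro exI[of _ "\<lambda>_. 0"] exI[of _ 0]) simp
  next
    case (step a x y)
    then obtain n c m where x: "x = (T ^^ n) f" and y: "y = (\<Sum>k<m. cscale (c k) ((T ^^ k) f))"
      and c: "\<forall>k\<ge>m. c k = 0" by auto
    define c' where "c' = c(n := c n + a)"
    define m' where "m' = max m (Suc n)"
    have "y = (\<Sum>k<m'. cscale (c k) ((T ^^ k) f))"
      unfolding y using c by (intro sum.mono_neutral_left) (auto simp: m'_def)
    moreover have "cscale a x = (\<Sum>k<m'. cscale (if k = n then a else 0) ((T ^^ k) f))"
      by (simp add: x m'_def if_distrib[of "\<lambda>c. cscale c _"] sum.delta cong: if_cong)
    ultimately have "cscale a x + y = (\<Sum>k<m'. cscale (c' k) ((T ^^ k) f))"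
      by (simp only: sum.distrib[symmetric] cfun.scale_left_distrib[symmetric] c'_def fun_upd_apply)
        (intro sum.cong arg_cong2[of _ _ _ _ cscale], auto)
    moreover have "\<forall>k\<ge>m'. c' k = 0"
      using c by (auto simp: c'_def m'_def)
    ultimately show ?case by blast
  qed
  then show thesis using that by blast
qed

text \<open>Otherwise Hahn-Banach gives a functional that vanishes on the orbit but not at
  \<open>g\<close>. It is dominated by the zero functional along the orbit, hence is 0 on
  \<open>E\<close>.\<close>

lemma orbit_span_norm_dense:
  assumes E: "cfun.subspace E" and N: "norm_on E N" and TE: "\<And>n. (T ^^ n) f \<in> E"
    and dense: "weak_topology E N closure_of {cscale c ((T ^^ n) f) | c n. True} = E"
    and g: "g \<in> E" and d: "0 < d"
  obtains h where "h \<in> cfun.span (range (\<lambda>n. (T ^^ n) f))" "N (g - h) < d"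
proof (rule ccontr)
  note * = that
  let ?M = "cfun.span (range (\<lambda>n. (T ^^ n) f))"
  assume "\<not> thesis"
  then have "d \<le> N (g - m)" if "m \<in> ?M" for m
    using \<open>\<not> thesis\<close> *[OF that] by force
  moreover have "?M \<subseteq> E"
    using TE by (intro cfun.span_minimal E) auto
  ultimately obtain u where u: "u \<in> dual E N" "\<And>m. m \<in> ?M \<Longrightarrow> u m = 0" "u g \<noteq> 0"
    using dual_separation[OF E N cfun.subspace_span _ g d] by blast
  have "u ((T ^^ n) f) = 0" for n
    by (intro u(2) cfun.span_base) auto
  then obtain c where "\<And>h. h \<in> E \<Longrightarrow> u h = c * 0"
    using weakly_dense_orbit_proportional[OF E TE dense u(1) dual_zero, of 0] by force
  with u(3) g show False by simp
qed

section \<open>Independence of evaluations at one or two points\<close>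

lemma evaluations_independentD:
  assumes "evaluations_independent E" "finite F" "\<And>f. f \<in> E \<Longrightarrow> (\<Sum>x\<in>F. c x * f x) = 0" "x \<in> F"
  shows "c x = 0"
  using assms by (auto simp: evaluations_independent_def eval_at_def)

lemma evaluations_not_proportional:
  assumes ind: "evaluations_independent E" and xy: "x \<noteq> y"
  shows "\<not> (\<forall>h\<in>E. a * h x = b * h y) \<or> a = 0 \<and> b = 0"
proof (rule disjCI)
  assume "\<not> (a = 0 \<and> b = 0)"
  define c where "c = (\<lambda>z. if z = x then a else - b)"
  show "\<not> (\<forall>h\<in>E. a * h x = b * h y)"
  proof
    assume "\<forall>h\<in>E. a * h x = b * h y"
    then have "(\<Sum>z\<in>{x, y}. c z * h z) = 0" if "h \<in> E" for h
      using that xy by (simp add: c_def)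
    from evaluations_independentD[OF ind _ this] have "c x = 0" "c y = 0" by auto
    with xy \<open>\<not> (a = 0 \<and> b = 0)\<close> show False by (simp add: c_def)
  qed
qed


section \<open>Weighted composition operators\<close>

text \<open>Fixes a weakly supercyclic vector \<open>f\<close>, from which a contradiction is to be
  derived.\<close>

locale weakly_dense_orbit =
  fixes E :: "('a::t2_space \<Rightarrow> complex) set" and N w \<phi> f
  assumes compact: "compact (UNIV :: 'a set)"
    and E: "cfun.subspace E" and N: "norm_on E N"
    and cont: "E \<subseteq> cont_funs"
    and incl: "continuous_map (norm_topology E N) (norm_topology cont_funs sup_norm) (\<lambda>f. f)"
    and ind: "evaluations_independent E"
    and TE: "wcomp w \<phi> ` E \<subseteq> E" and f: "f \<in> E"
    and dense: "weak_topology E N closure_of {cscale c ((wcomp w \<phi> ^^ n) f) | c n. True} = E"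
begin

abbreviation T where "T \<equiv> wcomp w \<phi>"

definition orb :: "nat \<Rightarrow> 'a \<Rightarrow> complex" where "orb n = (T ^^ n) f"

lemma funpow_in: "h \<in> E \<Longrightarrow> (T ^^ n) h \<in> E"
  using TE by (induction n) auto

lemma orb_in: "orb n \<in> E"
  using funpow_in[OF f] by (simp add: orb_def)

lemma orb_Suc: "orb (Suc n) x = w x * orb n (\<phi> x)"
  by (simp add: orb_def wcomp_def)

lemma eval: "(\<lambda>h. h x) \<in> dual E N"
  using eval_at_dual[OF compact incl, of x] by (simp add: eval_at_def[abs_def])

lemma proportional:
  assumes "u \<in> dual E N" "v \<in> dual E N" "\<And>n. cmod (u (orb n)) \<le> K * cmod (v (orb n))"
  obtains c where "\<And>h. h \<in> E \<Longrightarrow> u h = c * v h"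
  using weakly_dense_orbit_proportional[OF E funpow_in[OF f] dense assms(1,2), of K] assms(3)
  by (auto simp: orb_def)

text \<open>Domination would give \<open>\<delta>_x = c (a \<delta>_x + b \<delta>_y)\<close>;
  independence forces \<open>c b = 0\<close> and \<open>c a = 1\<close>, impossible for
  \<open>b \<noteq> 0\<close>.\<close>

lemma eval_proportional:
  assumes "x \<noteq> y" "\<And>n. cmod (orb n x) \<le> K * cmod (a * orb n x + b * orb n y)" "b \<noteq> 0"
  shows False
proof -
  obtain c where c: "\<And>h. h \<in> E \<Longrightarrow> h x = c * (a * h x + b * h y)"
    using proportional[OF eval dual_add[OF dual_scale[OF eval] dual_scale[OF eval]] assms(2)] by blast
  have "\<forall>h\<in>E. (1 - c * a) * h x = (c * b) * h y"
  proof
    fix h assume "h \<in> E"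
    from c[OF this] show "(1 - c * a) * h x = (c * b) * h y" by algebra
  qed
  with evaluations_not_proportional[OF ind assms(1)] have "1 - c * a = 0" "c * b = 0" by blast+
  with \<open>b \<noteq> 0\<close> show False by simp
qed

text \<open>Otherwise the evaluation at \<open>x\<close> is dominated by the zero functional along
  the orbit and vanishes on \<open>E\<close>.\<close>

lemma orb_nonzero: "\<exists>n. orb n x \<noteq> 0"
proof (rule ccontr)
  assume "\<not> ?thesis"
  then have "cmod (orb n x) \<le> 0 * cmod 0" for n by simp
  from proportional[OF eval dual_zero this] obtain c where "\<And>h. h \<in> E \<Longrightarrow> h x = c * 0"
    by blast
  then show False
    using evaluations_independentD[OF ind, of "{x}" "\<lambda>_. 1" x] by simp
qed

text \<open>If all ratios lay in the finite set \<open>R\<close>, a number \<open>z\<close> outside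
  \<open>R\<close> would have distance at least some \<open>e > 0\<close> from them. Then
  \<open>\<delta>_x\<close> is dominated by \<open>\<delta>_y - z \<delta>_x\<close> with constant
  \<open>1 / e\<close>, against \<open>eval_proportional\<close>.\<close>

lemma infinite_ratios:
  assumes "x \<noteq> y" "finite R"
  obtains n where "orb n x \<noteq> 0" "orb n y / orb n x \<notin> R"
proof (rule ccontr)
  note * = that
  assume "\<not> thesis"
  then have R: "orb n y / orb n x \<in> R" if "orb n x \<noteq> 0" for n
    using *[OF that] by blast
  obtain z where z: "z \<notin> R"
    using ex_new_if_finite[OF infinite_UNIV_char_0 assms(2)] by blast
  obtain e where e: "0 < e" "\<And>r. r \<in> R \<Longrightarrow> e \<le> dist z r"
    using finite_set_avoid[OF assms(2), of z] z by metis
  have "cmod (orb n x) \<le> (1 / e) * cmod (- z * orb n x + 1 * orb n y)" for n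
  proof (cases "orb n x = 0")
    case False
    have "e * cmod (orb n x) \<le> dist z (orb n y / orb n x) * cmod (orb n x)"
      by (intro mult_right_mono e R False) simp
    also have "\<dots> = cmod ((orb n y / orb n x - z) * orb n x)"
      by (simp add: norm_mult dist_norm norm_minus_commute)
    also have "(orb n y / orb n x - z) * orb n x = - z * orb n x + 1 * orb n y"
      using False by (simp add: field_simps)
    finally show ?thesis using e(1) by (simp add: field_simps)
  qed (use e in simp)
  from eval_proportional[OF assms(1) this] show False by simp
qed

text \<open>If \<open>w x = 0\<close>, then \<open>orb n x = 0\<close> for all \<open>n > 0\<close>,
  which leaves only the ratio at \<open>n = 0\<close>.\<close>

lemma weight_nonzero:
  assumes "\<exists>x y :: 'a. x \<noteq> y"
  shows "w x \<noteq> 0"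
proof
  assume w: "w x = 0"
  obtain y where "x \<noteq> y" using assms by metis
  then obtain n where n: "orb n x \<noteq> 0" "orb n y / orb n x \<notin> {orb 0 y / orb 0 x}"
    by (rule infinite_ratios[where R = "{orb 0 y / orb 0 x}"]) auto
  with w show False by (cases n) (auto simp: orb_Suc)
qed

text \<open>If \<open>\<phi>\<close> were the identity, \<open>T\<close> would multiply by
  \<open>w\<close>. Of two points, the one with the smaller weight has its evaluation dominated by
  the other along the orbit.\<close>

lemma exists_non_fixed:
  assumes "\<exists>x y :: 'a. x \<noteq> y"
  shows "\<exists>x. \<phi> x \<noteq> x"
proof (rule ccontr)
  assume "\<not> ?thesis"
  then have orb: "orb n x = w x ^ n * f x" for n x
    by (induction n) (simp_all add: orb_Suc, simp add: orb_def)
  have "f x \<noteq> 0" for x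
    using orb_nonzero[of x] by (auto simp: orb)
  have False if xy: "x \<noteq> y" and le: "cmod (w x) \<le> cmod (w y)" for x y
  proof (rule eval_proportional[OF xy, of "cmod (f x) / cmod (f y)" 0 1])
    fix n
    have "cmod (w x) ^ n * cmod (f x) \<le> cmod (w y) ^ n * cmod (f x)"
      by (intro mult_right_mono power_mono le) auto
    then show "cmod (orb n x) \<le> cmod (f x) / cmod (f y) * cmod (0 * orb n x + 1 * orb n y)"
      using \<open>f y \<noteq> 0\<close> by (simp add: orb norm_mult norm_power mult.commute)
  qed simp
  with assms show False by (metis linear)
qed

text \<open>A repetition makes the orbit of \<open>x\<close> finite. The ratio
  \<open>orb n (\<phi> x) / orb n x\<close> depends only on the point reached after \<open>n\<close>
  steps, so it takes finitely many values, against \<open>infinite_ratios\<close>.\<close>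

lemma orbit_inj:
  assumes w: "\<And>x. w x \<noteq> 0" and x: "\<phi> x \<noteq> x"
  shows "inj (\<lambda>n. (\<phi> ^^ n) x)"
proof (rule ccontr)
  assume "\<not> ?thesis"
  then obtain m p where p: "0 < p" "(\<phi> ^^ (m + p)) x = (\<phi> ^^ m) x"
    unfolding inj_def by (metis less_imp_add_positive linorder_neqE_nat)
  have "(\<phi> ^^ n) x \<in> (\<lambda>n. (\<phi> ^^ n) x) ` {..<m + p}" for n
  proof (induction n rule: less_induct)
    case (less n)
    show ?case
    proof (cases "n < m + p")
      case False
      \<comment> \<open>One period \<open>p\<close> is removed: the new index is
        \<open>n - p\<close>.\<close>
      have "n = (n - (m + p)) + (m + p)" using False by simp
      then have "(\<phi> ^^ n) x = (\<phi> ^^ (n - (m + p))) ((\<phi> ^^ (m + p)) x)"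
        by (metis funpow_add comp_apply)
      also have "\<dots> = (\<phi> ^^ (n - (m + p) + m)) x"
        by (subst p(2)) (simp only: funpow_add comp_apply)
      finally show ?thesis using less[of "n - (m + p) + m"] False p(1) by simp
    qed simp
  qed
  then have fin: "finite (range (\<lambda>n. (\<phi> ^^ n) x))"
    by (intro finite_subset[OF _ finite_imageI[OF finite_lessThan]]) blast
  define G where "G z = T f z / (w x * f z)" for z
  obtain n where n: "orb n x \<noteq> 0" "orb n (\<phi> x) / orb n x \<notin> G ` range (\<lambda>n. (\<phi> ^^ n) x)"
    using infinite_ratios[OF x[symmetric] finite_imageI[OF fin]] by blast
  define W where "W = (\<Prod>k<n. w ((\<phi> ^^ k) x))"
  have W: "W \<noteq> 0" using w by (simp add: W_def)
  \<comment> \<open>Both sides are \<open>T^(n+1) f\<close> at \<open>x\<close>, with the extra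
    factor \<open>T\<close> split off on the outside or on the inside.\<close>
  have "w x * orb n (\<phi> x) = (T ^^ n) (T f) x"
    using orb_Suc[of n x] by (simp only: orb_def funpow_Suc_right comp_apply)
  also have "\<dots> = W * T f ((\<phi> ^^ n) x)"
    by (simp add: wcomp_funpow W_def)
  finally have 1: "orb n (\<phi> x) = W * T f ((\<phi> ^^ n) x) / w x"
    using w by (simp add: field_simps)
  have 2: "orb n x = W * f ((\<phi> ^^ n) x)"
    by (simp add: orb_def wcomp_funpow W_def)
  have "orb n (\<phi> x) / orb n x = G ((\<phi> ^^ n) x)"
    unfolding 1 2 G_def using W by (simp add: field_simps)
  with n(2) show False by blast
qed

text \<open>By compactness \<open>|g|\<close> has a positive lower bound \<open>e\<close>. Norm
  density and continuity of the inclusion give an \<open>h\<close> in the span of the orbit with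
  \<open>sup_norm (g - h) < e\<close>.\<close>

lemma exists_nonvanishing_combination:
  assumes "g \<in> E" "\<And>x. g x \<noteq> 0"
  obtains c m where "\<And>x. (\<Sum>k<m. c k * orb k x) \<noteq> 0"
proof -
  have gc: "continuous_on UNIV g" using assms(1) cont by (auto simp: cont_funs_def)
  obtain e where e: "0 < e" "\<And>x. e \<le> cmod (g x)"
    by (rule bounded_below_nonvanishing[of g]) (use compact gc assms(2) in auto)
  interpret ME: Metric_space E "norm_dist E N"
    by (rule Metric_space_norm_dist[OF E N])
  have "Metric_space cont_funs (norm_dist cont_funs (sup_norm :: ('a \<Rightarrow> complex) \<Rightarrow> real))"
    by (rule Metric_space_norm_dist[OF subspace_cont_funs norm_on_cont_funs[OF compact]])
  note incl[unfolded norm_topology_def ME.metric_continuous_map[OF this], THEN conjunct2,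
      rule_format, OF assms(1) e(1)]
  then obtain d where d: "0 < d"
    "\<And>h. h \<in> E \<Longrightarrow> norm_dist E N g h < d \<Longrightarrow> norm_dist cont_funs sup_norm g h < e"
    by auto
  obtain h where h: "h \<in> cfun.span (range (\<lambda>n. (T ^^ n) f))" "N (g - h) < d"
    using orbit_span_norm_dense[OF E N funpow_in[OF f] dense assms(1) d(1)] by blast
  have hE: "h \<in> E"
    using h(1) cfun.span_minimal[OF _ E, of "range (\<lambda>n. (T ^^ n) f)"] funpow_in[OF f] by blast
  have gh: "g \<in> cont_funs" "h \<in> cont_funs"
    using assms(1) hE cont by auto
  then have small: "sup_norm (g - h) < e"
    using d(2)[OF hE] h(2) assms(1) hE by (simp add: norm_dist_def)
  have "h x \<noteq> 0" for x
    using cmod_le_sup_norm[OF compact cfun.subspace_diff[OF subspace_cont_funs gh], of x] small e(2)[of x]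
    by auto
  moreover obtain c m where "h = (\<Sum>k<m. cscale (c k) ((T ^^ k) f))"
    using orbit_span_eq[OF h(1)] by blast
  ultimately show thesis
    by (intro that[where c = c and m = m]) (simp add: cscale_sum_apply orb_def)
qed

text \<open>With \<open>F = p(T) f\<close> and \<open>z = \<phi>\<^sup>n x\<close>, the functionals \<open>\<delta>\<^sub>x p(T)\<close> and \<open>\<delta>\<^sub>x p(T) T\<close> take on
  \<open>T\<^sup>n f\<close> the values \<open>F z\<close> and \<open>T F z\<close> times a common factor, so the second is bounded by the first
  if \<open>F\<close> has no zeros.\<close>

lemma no_nonvanishing_combination:
  assumes w: "\<And>x. w x \<noteq> 0" and wcont: "continuous_on UNIV w" and \<phi>cont: "continuous_on UNIV \<phi>"
    and inj: "inj (\<lambda>n. (\<phi> ^^ n) x)" and nz: "\<And>x. (\<Sum>k<m. c k * orb k x) \<noteq> 0"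
  shows False
proof -
  \<comment> \<open>Extended by 0 so that \<open>a m = 0\<close>, the start of the downward
    induction below.\<close>
  define a where "a k = (if k < m then c k else 0)" for k
  define F where "F z = (\<Sum>k<m. a k * orb k z)" for z
  define W where "W k = (\<Prod>j<k. w ((\<phi> ^^ j) x))" for k
  define u where "u h = (\<Sum>k<m. a k * (T ^^ k) h x)" for h
  define v where "v h = (\<Sum>k<m. a k * (T ^^ Suc k) h x)" for h
  have W: "W k \<noteq> 0" for k using w by (simp add: W_def)
  have Tx: "(T ^^ k) h x = W k * h ((\<phi> ^^ k) x)" for k h
    by (simp add: wcomp_funpow W_def)
  have functional: "(\<lambda>h. b * (T ^^ k) h x) \<in> dual E N" for b k
    unfolding Tx by (intro dual_scale eval)
  have u: "u \<in> dual E N" and v: "v \<in> dual E N"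
    unfolding u_def[abs_def] v_def[abs_def] by (intro dual_sum functional)+
  have F: "F z \<noteq> 0" for z using nz[of z] by (simp add: F_def a_def)
  have orb_cont: "continuous_on UNIV (orb k)" for k
    using orb_in[of k] cont by (auto simp: cont_funs_def)
  have Fcont: "continuous_on UNIV F"
    unfolding F_def[abs_def] by (intro continuous_intros orb_cont)
  have "continuous_on UNIV (\<lambda>z. w z * F (\<phi> z) / F z)"
    by (intro continuous_intros wcont Fcont continuous_on_compose2[OF Fcont \<phi>cont]) (auto simp: F)
  then have "bounded (range (\<lambda>z. w z * F (\<phi> z) / F z))"
    by (intro compact_imp_bounded compact_continuous_image compact)
  then obtain C where C: "\<And>z. cmod (w z * F (\<phi> z) / F z) \<le> C"
    by (auto simp: bounded_iff)
  have C: "cmod (w z * F (\<phi> z)) \<le> C * cmod (F z)" for z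
    using C[of z] F[of z] by (simp add: norm_divide pos_divide_le_eq)
  have orb_add: "(T ^^ k) (orb n) x = W n * orb k ((\<phi> ^^ n) x)" for k n
  proof -
    have "(T ^^ k) (orb n) = (T ^^ n) (orb k)"
      by (metis orb_def funpow_add comp_apply add.commute)
    then show ?thesis by (simp add: Tx)
  qed
  have un: "u (orb n) = W n * F ((\<phi> ^^ n) x)" for n
    by (simp only: u_def orb_add F_def sum_distrib_left mult.left_commute)
  have vn: "v (orb n) = W n * (w ((\<phi> ^^ n) x) * F (\<phi> ((\<phi> ^^ n) x)))" for n
    by (simp only: v_def orb_add F_def orb_Suc sum_distrib_left mult.left_commute)
  have "cmod (v (orb n)) \<le> C * cmod (u (orb n))" for n
    using mult_left_mono[OF C[of "(\<phi> ^^ n) x"], of "cmod (W n)"]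
    by (simp add: un vn norm_mult mult.left_commute)
  then obtain b where b: "\<And>h. h \<in> E \<Longrightarrow> v h = b * u h"
    using proportional[OF v u] by blast
  \<comment> \<open>The coefficients of \<open>p\<close> shifted by one degree, as \<open>v\<close>
    comes from \<open>p(T) T\<close>.\<close>
  define a' where "a' k = (case k of 0 \<Rightarrow> 0 | Suc j \<Rightarrow> a j)" for k
  have rec: "a' k = b * a k" if k: "k \<le> m" for k
  proof -
    define y where "y k = (\<phi> ^^ k) x" for k
    have y: "inj y" using inj by (simp add: y_def[abs_def])
    \<comment> \<open>Independence takes coefficients indexed by points, so the index
      \<open>k\<close> is recovered from \<open>y k\<close> by injectivity.\<close>
    define q where "q z = (let k = inv y z in (a' k - b * a k) * W k)" for z
    have q: "q (y k) = (a' k - b * a k) * W k" for k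
      using inv_f_f[OF y] by (simp add: q_def)
    have "(\<Sum>z\<in>y ` {..m}. q z * h z) = 0" if h: "h \<in> E" for h
    proof -
      have "v h = (\<Sum>k\<le>m. a' k * (W k * h (y k)))"
        unfolding v_def Tx by (subst sum.atMost_shift) (simp add: a'_def y_def)
      moreover have "u h = (\<Sum>k\<le>m. a k * (W k * h (y k)))"
        unfolding u_def Tx by (simp add: y_def a_def flip: lessThan_Suc_atMost)
      ultimately have "(\<Sum>k\<le>m. a' k * (W k * h (y k))) - b * (\<Sum>k\<le>m. a k * (W k * h (y k))) = 0"
        using b[OF h] by simp
      then have "(\<Sum>k\<le>m. q (y k) * h (y k)) = 0"
        by (simp add: q sum_distrib_left algebra_simps flip: sum_subtractf)
      then show ?thesis
        by (simp add: sum.reindex[OF inj_on_subset[OF y]])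
    qed
    from evaluations_independentD[OF ind _ this, of "y k"] k
    have "q (y k) = 0" by simp
    with W[of k] show ?thesis by (simp add: q)
  qed
  \<comment> \<open>From the top down: \<open>a k = a' (k + 1) = b * a (k + 1)\<close>, starting
    with \<open>a m = 0\<close>.\<close>
  have "a (m - i) = 0" if "i \<le> m" for i
    using that
  proof (induction i)
    case (Suc i)
    then have "a' (m - i) = 0" using rec[of "m - i"] by simp
    moreover have "m - i = Suc (m - Suc i)" using Suc.prems by simp
    ultimately show ?case by (simp add: a'_def)
  qed (simp add: a_def)
  from this[of "m - k" for k] have "a k = 0" if "k < m" for k
    using that by (metis diff_diff_cancel diff_le_self less_imp_le)
  then have "F x = 0" by (simp add: F_def)
  with F show False by blast
qed

end

theorem theoremA:
  fixes E :: "('a::t2_space \<Rightarrow> complex) set"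
    and N :: "('a \<Rightarrow> complex) \<Rightarrow> real"
    and w :: "'a \<Rightarrow> complex"
    and \<phi> :: "'a \<Rightarrow> 'a"
  assumes "compact (UNIV :: 'a set)"
    and "\<exists>x y :: 'a. x \<noteq> y"
    and "banach_space_on E N"
    and "infinite_dimensional E"
    and "E \<subseteq> cont_funs"
    and "continuous_map (norm_topology E N) (norm_topology cont_funs sup_norm) (\<lambda>f. f)"
    and "evaluations_independent E"
    and "\<exists>g\<in>E. \<forall>x. g x \<noteq> 0"
    and "continuous_on UNIV w"
    and "continuous_on UNIV \<phi>"
    and "wcomp w \<phi> ` E \<subseteq> E"
    and "continuous_map (norm_topology E N) (norm_topology E N) (wcomp w \<phi>)"
  shows "\<not> weakly_supercyclic E N (wcomp w \<phi>)"
proof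
  assume "weakly_supercyclic E N (wcomp w \<phi>)"
  then obtain f where "f \<in> E"
    "weak_topology E N closure_of {cscale c ((wcomp w \<phi> ^^ n) f) | c n. True} = E"
    by (auto simp: weakly_supercyclic_def)
  then interpret weakly_dense_orbit E N w \<phi> f
    using assms by unfold_locales (auto simp: banach_space_on_def)
  obtain x where "\<phi> x \<noteq> x" using exists_non_fixed assms(2) by blast
  then have "inj (\<lambda>n. (\<phi> ^^ n) x)" by (rule orbit_inj[OF weight_nonzero[OF assms(2)]])
  moreover obtain c m where "\<And>x. (\<Sum>k<m. c k * orb k x) \<noteq> 0"
    using exists_nonvanishing_combination assms(8) by blast
  ultimately show False
    using no_nonvanishing_combination[OF weight_nonzero[OF assms(2)] assms(9,10)] by blast
qed

end
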